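(* Let $(a_n)_{n\ge0}$ be a real sequence with $a_0\neq0$ and let $(R_n)$ be the Appell sequence generated by it. Suppose the Borel kernel $s\mapsto A(-s)$ is a function defined and infinitely differentiable on $[0,\infty)$, satisfying $|A(-s)|\le Ce^{bs}$ for all $s\ge0$, for some constants $C>0$, $b\ge0$, and having the asymptotic Taylor behaviour \[ A(-s)\sim\sum_{n\ge0}(-1)^na_n\frac{s^n}{n!}\qquad(s\to0^+). \] Then for every fixed $t\in\mathbb R$ the integral \[ L_A(x+t):=\int_0^\infty e^{-xs}A(-s)e^{-ts}\,ds \] converges absolutely for $x>b-t$, and \[ L_A(x+t)\sim\sum_{n\ge0}(-1)^n\frac{R_n(t)}{x^{n+1}}\qquad(x\to\infty). \] The growth bound is only a sufficient condition; for a rapidly decaying kernel such as the Gaussian $A(-s)=e^{-s^2/2}$ the integral converges for all real $x$.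
   Context: The Appell sequence generated by $(a_n)$ is $R_n(t)=\sum_{k=0}^n\binom nk a_kt^{n-k}$. The formal series $A(z)=\sum_{n\ge0}a_nz^n/n!$ need not converge; $A(-s)$ denotes a given function on $[0,\infty)$ whose asymptotic expansion at $0^+$ is the stated one. Asymptotic notation: $g(s)\sim\sum_n c_ns^n$ ($s\to0^+$) means $g(s)=\sum_{n=0}^Nc_ns^n+o(s^N)$ for every $N$; $h(x)\sim\sum_n d_nx^{-n-1}$ ($x\to\infty$) means $h(x)=\sum_{n=0}^Nd_nx^{-n-1}+o(x^{-N-1})$ for every $N$. *)

theory Defs
  imports "HOL-Analysis.Analysis" "HOL-Library.Landau_Symbols"
begin

definition appell :: "(nat \<Rightarrow> real) \<Rightarrow> nat \<Rightarrow> real \<Rightarrow> real" where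
  "appell a n t = (\<Sum>k\<le>n. real (n choose k) * a k * t ^ (n - k))"

(* D n is the n-th derivative; derivatives are taken within S, so they are
   one-sided at the endpoint 0 when S = {0..}. *)
definition infinitely_differentiable_on :: "(real \<Rightarrow> real) \<Rightarrow> real set \<Rightarrow> bool" where
  "infinitely_differentiable_on f S \<longleftrightarrow>
     (\<exists>D :: nat \<Rightarrow> real \<Rightarrow> real.
        (\<forall>x\<in>S. D 0 x = f x) \<and>
        (\<forall>n. \<forall>x\<in>S. (D n has_real_derivative D (Suc n) x) (at x within S)))"

definition asymp_series_at_zero :: "(real \<Rightarrow> real) \<Rightarrow> (nat \<Rightarrow> real) \<Rightarrow> bool" where
  "asymp_series_at_zero g c \<longleftrightarrow>
     (\<forall>N. (\<lambda>s. g s - (\<Sum>n\<le>N. c n * s ^ n)) \<in> o[at_right 0](\<lambda>s. s ^ N))"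

definition asymp_series_at_top :: "(real \<Rightarrow> real) \<Rightarrow> (nat \<Rightarrow> real) \<Rightarrow> bool" where
  "asymp_series_at_top h d \<longleftrightarrow>
     (\<forall>N. (\<lambda>x. h x - (\<Sum>n\<le>N. d n / x ^ (n + 1))) \<in> o[at_top](\<lambda>x. 1 / x ^ (N + 1)))"

(* In the following, K stands for the Borel kernel, K s = A (- s). *)
definition borel_integrand :: "(real \<Rightarrow> real) \<Rightarrow> real \<Rightarrow> real \<Rightarrow> real \<Rightarrow> real" where
  "borel_integrand K x t s = exp (- (x * s)) * K s * exp (- (t * s))"

definition borel_laplace :: "(real \<Rightarrow> real) \<Rightarrow> real \<Rightarrow> real \<Rightarrow> real" where
  "borel_laplace K x t = set_lebesgue_integral lebesgue {0..} (borel_integrand K x t)"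

(* Decay faster than every exponential; polynomial or simple exponential decay would
   not make the integral converge for all real x. *)
definition rapidly_decaying :: "(real \<Rightarrow> real) \<Rightarrow> bool" where
  "rapidly_decaying K \<longleftrightarrow> (\<forall>c. K \<in> O[at_top](\<lambda>s. exp (- (c * s))))"

definition gaussian_kernel :: "real \<Rightarrow> real" where
  "gaussian_kernel s = exp (- (s\<^sup>2 / 2))"

end

theory Submission
  imports Defs "HOL-Probability.Distributions" "HOL-Real_Asymp.Real_Asymp"
begin

text \<open>Multiplying the expansion of the kernel at \<open>0\<close> by that of \<open>exp (- t * s)\<close> gives the coefficients
  \<open>(- 1) ^ n * R\<^sub>n(t) / n!\<close>, so the expansion is Watson's lemma for the product. Watson's lemma needs no
  splitting of the integral: a remainder that is \<open>O(s ^ (N + 1))\<close> at \<open>0\<close> and of exponential growth is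
  dominated on the whole half-line by \<open>M * s ^ (N + 1) * exp (\<gamma> * s)\<close>, whose Laplace transform
  \<open>M * (N + 1)! / (x - \<gamma>) ^ (N + 2)\<close> is \<open>o(x ^ (- N - 1))\<close>.\<close>

section \<open>Laplace integrals of powers and of functions of exponential growth\<close>

text \<open>After normalization the integrand is the Erlang density of rate \<open>y\<close>, whose
  total mass is its moment of order 0.\<close>

lemma has_bochner_integral_power_exp:
  fixes y :: real
  assumes "y > 0"
  shows "has_bochner_integral lebesgue (\<lambda>s. indicator {0..} s *\<^sub>R (s ^ n * exp (- (y * s))))
           (fact n / y ^ (n + 1))"
proof -
  have eq: "indicator {0..} s *\<^sub>R (s ^ n * exp (- (y * s))) =
      fact n / y ^ (n + 1) * erlang_density n y s" for s :: real
    using assms by (simp add: erlang_density_def indicator_def field_simps)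
  have "(\<integral>\<^sup>+ s. ennreal (erlang_density n y s) \<partial>lborel) = 1"
    using nn_integral_erlang_ith_moment[OF assms, of n 0] by simp
  then have "has_bochner_integral lborel (erlang_density n y) 1"
    using assms by (intro has_bochner_integral_nn_integral) auto
  \<comment> \<open>\<open>borel_laplace\<close> integrates against the completed measure; for a
    Borel function the completion changes neither integrability nor the value.\<close>
  then have "has_bochner_integral lebesgue (erlang_density n y) 1"
    by (simp add: has_bochner_integral_iff integrable_completion integral_completion)
  from has_bochner_integral_mult_right[OF this, of "fact n / y ^ (n + 1)"]
  show ?thesis
    by (simp only: eq) simp
qed

lemma absolutely_integrable_power_exp:
  fixes y :: real
  assumes "y > 0"
  shows "(\<lambda>s. s ^ n * exp (- (y * s))) absolutely_integrable_on {0..}"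
  using has_bochner_integral_power_exp[OF assms, of n]
  by (simp add: set_integrable_def has_bochner_integral_iff)

text \<open>Domination by the preceding integral at rate \<open>x - c\<close>. The case
  \<open>n = 0\<close> yields mere convergence; \<open>n = Suc N\<close> yields the decay of the
  remainder in Watson's lemma.\<close>

lemma absolutely_integrable_exp_bound:
  fixes f :: "real \<Rightarrow> real"
  assumes f: "continuous_on {0..} f"
    and M: "\<And>s. s \<ge> 0 \<Longrightarrow> \<bar>f s\<bar> \<le> M * (s ^ n * exp (c * s))"
    and x: "x > c"
  shows "(\<lambda>s. exp (- (x * s)) * f s) absolutely_integrable_on {0..}"
    and "\<bar>LINT s:{0..}|lebesgue. exp (- (x * s)) * f s\<bar> \<le> M * (fact n / (x - c) ^ (n + 1))"
proof -
  let ?h = "\<lambda>s. exp (- (x * s)) * f s"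
  let ?g = "\<lambda>s. M * (s ^ n * exp (- ((x - c) * s)))"
  have g: "?g absolutely_integrable_on {0..}"
    using absolutely_integrable_power_exp[of "x - c" n] x by simp
  have le: "\<bar>?h s\<bar> \<le> ?g s" if "s \<ge> 0" for s
  proof -
    have "\<bar>?h s\<bar> \<le> exp (- (x * s)) * (M * (s ^ n * exp (c * s)))"
      using M[OF that] by (simp add: abs_mult)
    also have "\<dots> = ?g s"
      by (simp add: algebra_simps flip: exp_add)
    finally show ?thesis .
  qed
  show h: "?h absolutely_integrable_on {0..}"
  proof (rule measurable_bounded_by_integrable_imp_absolutely_integrable)
    show "?h \<in> borel_measurable (lebesgue_on {0..})"
      by (intro continuous_imp_measurable_on_sets_lebesgue continuous_intros f) auto
    show "?g integrable_on {0..}"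
      using g by (rule set_lebesgue_integral_eq_integral)
  qed (use le in auto)
  have "\<bar>LINT s:{0..}|lebesgue. ?h s\<bar> \<le> (LINT s:{0..}|lebesgue. \<bar>?h s\<bar>)"
    using set_integral_norm_bound[OF h] by simp
  also have "\<dots> \<le> (LINT s:{0..}|lebesgue. ?g s)"
    using le h g by (intro set_integral_mono set_integrable_abs) auto
  also have "\<dots> = M * (fact n / (x - c) ^ (n + 1))"
    using has_bochner_integral_power_exp[of "x - c" n] x
    by (simp add: set_lebesgue_integral_def has_bochner_integral_iff)
  finally show "\<bar>LINT s:{0..}|lebesgue. ?h s\<bar> \<le> M * (fact n / (x - c) ^ (n + 1))" .
qed

section \<open>Remainder bounds for an expansion at 0\<close>

text \<open>Expanding one order further and moving the extra term back trades
  \<open>o(s ^ N)\<close> for a big-O of the next power, which supplies an explicit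
  constant.\<close>

lemma asymp_series_at_zero_remainder:
  assumes "asymp_series_at_zero g c"
  shows "(\<lambda>s. g s - (\<Sum>n\<le>N. c n * s ^ n)) \<in> O[at_right 0](\<lambda>s. s ^ Suc N)"
proof -
  have "(\<lambda>s. g s - (\<Sum>n\<le>Suc N. c n * s ^ n)) \<in> O[at_right 0](\<lambda>s. s ^ Suc N)"
    using assms unfolding asymp_series_at_zero_def by (blast intro: landau_o.small_imp_big)
  moreover have "(\<lambda>s. c (Suc N) * s ^ Suc N) \<in> O[at_right 0](\<lambda>s. s ^ Suc N)"
    by simp
  ultimately have "(\<lambda>s. (g s - (\<Sum>n\<le>Suc N. c n * s ^ n)) + c (Suc N) * s ^ Suc N)
      \<in> O[at_right 0](\<lambda>s. s ^ Suc N)"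
    by (rule sum_in_bigo)
  then show ?thesis
    by (simp add: algebra_simps)
qed

text \<open>The filter \<open>at_right 0\<close> ignores the point 0 itself, so continuity has to
  link the value there to the expansion.\<close>

lemma asymp_series_at_zero_value:
  assumes g: "asymp_series_at_zero g c" and cont: "continuous_on {0..} g"
  shows "g 0 = c 0"
proof -
  have "(\<lambda>s. g s - c 0) \<in> o[at_right 0](\<lambda>s. 1)"
    using g[unfolded asymp_series_at_zero_def, rule_format, of 0] by simp
  then have "((\<lambda>s. g s - c 0) \<longlongrightarrow> 0) (at_right 0)"
    using smalloD_tendsto by fastforce
  then have "(g \<longlongrightarrow> c 0) (at_right 0)"
    by (simp add: LIM_zero_iff)
  moreover have "(g \<longlongrightarrow> g 0) (at_right 0)"
    using cont by (auto simp: continuous_on_def intro: tendsto_within_subset)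
  ultimately show ?thesis
    using tendsto_unique trivial_limit_at_right_real by blast
qed

text \<open>Each term of the truncated series with \<^term>\<open>n \<le> N\<close> is at most \<open>\<bar>c n\<bar> * \<delta> ^ n * (s / \<delta>) ^ Suc N\<close>
  once \<^term>\<open>s \<ge> \<delta>\<close>, so the local bound extends to the whole half-line.\<close>

lemma remainder_global_bound:
  fixes f :: "real \<Rightarrow> real"
  assumes cont: "continuous_on {0..} f"
    and growth: "\<And>s. s \<ge> 0 \<Longrightarrow> \<bar>f s\<bar> \<le> C * exp (\<beta> * s)"
    and taylor: "asymp_series_at_zero f c"
  obtains M \<gamma> where "\<And>s. s \<ge> 0 \<Longrightarrow>
    \<bar>f s - (\<Sum>n\<le>N. c n * s ^ n)\<bar> \<le> M * (s ^ Suc N * exp (\<gamma> * s))"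
proof -
  let ?r = "\<lambda>s. f s - (\<Sum>n\<le>N. c n * s ^ n)"
  obtain B where "B > 0" and "eventually (\<lambda>s. norm (?r s) \<le> B * norm (s ^ Suc N)) (at_right 0)"
    using asymp_series_at_zero_remainder[OF taylor, of N] by (elim landau_o.bigE) blast
  then obtain d where d: "d > 0" and near: "\<And>s. s > 0 \<Longrightarrow> s < d \<Longrightarrow> \<bar>?r s\<bar> \<le> B * s ^ Suc N"
    unfolding eventually_at_right_field by (auto simp: abs_mult power_abs)
  \<comment> \<open>\<open>E\<close> collects the constants of \<open>f\<close> and of the truncated
    series beyond \<open>d\<close>; \<open>M\<close> serves both ranges. Taking
    \<open>\<gamma>\<close> nonnegative makes \<open>exp (\<gamma> * s)\<close> at least 1, so that
    it can be inserted into the bound near 0 too.\<close>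
  define E where "E = C + (\<Sum>n\<le>N. \<bar>c n\<bar> * d ^ n)"
  define M where "M = max B (E / d ^ Suc N)"
  define \<gamma> where "\<gamma> = max \<beta> 0"
  have "C \<ge> 0"
    using growth[of 0] by simp
  have bound: "\<bar>?r s\<bar> \<le> M * (s ^ Suc N * exp (\<gamma> * s))" if s: "s \<ge> 0" for s
  proof -
    have exp1: "1 \<le> exp (\<gamma> * s)"
      using s by (simp add: \<gamma>_def)
    consider "s = 0" | "0 < s" "s < d" | "d \<le> s"
      using s by linarith
    then show ?thesis
    proof cases
      case 1
      \<comment> \<open>The right-hand side vanishes at 0, so the remainder must be exactly 0
        there.\<close>
      have "(\<Sum>n\<le>N. c n * 0 ^ n) = c 0"
        by (simp add: sum.atMost_shift)
      then show ?thesis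
        using asymp_series_at_zero_value[OF taylor cont] 1 by simp
    next
      case 2
      have "\<bar>?r s\<bar> \<le> B * (s ^ Suc N * 1)"
        using near 2 by simp
      also have "\<dots> \<le> M * (s ^ Suc N * exp (\<gamma> * s))"
        using \<open>B > 0\<close> exp1 s by (intro mult_mono) (auto simp: M_def)
      finally show ?thesis .
    next
      case 3
      define q where "q = (s / d) ^ Suc N"
      have q: "1 \<le> q"
        using 3 d by (simp only: q_def) (intro one_le_power, simp)
      have "\<bar>f s\<bar> \<le> C * exp (\<beta> * s)"
        using growth s by simp
      also have "\<dots> \<le> C * exp (\<gamma> * s)"
        using \<open>C \<ge> 0\<close> s by (intro mult_left_mono) (auto simp: \<gamma>_def intro: mult_right_mono)
      also have "\<dots> \<le> C * (q * exp (\<gamma> * s))"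
        using \<open>C \<ge> 0\<close> q by (intro mult_left_mono) auto
      finally have 1: "\<bar>f s\<bar> \<le> C * (q * exp (\<gamma> * s))" .
      have "\<bar>\<Sum>n\<le>N. c n * s ^ n\<bar> \<le> (\<Sum>n\<le>N. \<bar>c n * s ^ n\<bar>)"
        by (rule sum_abs)
      also have "\<dots> \<le> (\<Sum>n\<le>N. \<bar>c n\<bar> * d ^ n * (q * exp (\<gamma> * s)))"
      proof (rule sum_mono)
        fix n assume "n \<in> {..N}"
        then have "(s / d) ^ n \<le> q"
          unfolding q_def using 3 d by (intro power_increasing) auto
        then have "(s / d) ^ n * 1 \<le> q * exp (\<gamma> * s)"
          using q exp1 by (intro mult_mono) auto
        then have "\<bar>c n\<bar> * d ^ n * (s / d) ^ n \<le> \<bar>c n\<bar> * d ^ n * (q * exp (\<gamma> * s))"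
          using d by (intro mult_left_mono) auto
        then show "\<bar>c n * s ^ n\<bar> \<le> \<bar>c n\<bar> * d ^ n * (q * exp (\<gamma> * s))"
          using d s by (simp add: abs_mult power_divide)
      qed
      finally have "\<bar>?r s\<bar> \<le> E * (q * exp (\<gamma> * s))"
        using 1 by (simp add: E_def sum_distrib_right distrib_right)
      also have "\<dots> = E / d ^ Suc N * (s ^ Suc N * exp (\<gamma> * s))"
        by (simp add: q_def power_divide)
      also have "\<dots> \<le> M * (s ^ Suc N * exp (\<gamma> * s))"
        using s by (intro mult_right_mono) (auto simp: M_def)
      finally show ?thesis .
    qed
  qed
  show thesis
    by (rule that) (rule bound)
qed

section \<open>Watson's lemma\<close>

theorem watson:
  fixes f :: "real \<Rightarrow> real"
  assumes cont: "continuous_on {0..} f"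
    and growth: "\<And>s. s \<ge> 0 \<Longrightarrow> \<bar>f s\<bar> \<le> C * exp (\<beta> * s)"
    and taylor: "asymp_series_at_zero f c"
  shows "asymp_series_at_top (\<lambda>x. LINT s:{0..}|lebesgue. exp (- (x * s)) * f s) (\<lambda>n. fact n * c n)"
  unfolding asymp_series_at_top_def
proof
  fix N
  let ?L = "\<lambda>x. LINT s:{0..}|lebesgue. exp (- (x * s)) * f s"
  let ?R = "\<lambda>x. ?L x - (\<Sum>n\<le>N. fact n * c n / x ^ (n + 1))"
  let ?r = "\<lambda>s. f s - (\<Sum>n\<le>N. c n * s ^ n)"
  obtain M \<gamma> where M: "\<And>s. s \<ge> 0 \<Longrightarrow> \<bar>?r s\<bar> \<le> M * (s ^ Suc N * exp (\<gamma> * s))"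
    using remainder_global_bound[OF assms] by blast
  have cont_r: "continuous_on {0..} ?r"
    by (intro continuous_intros cont)
  \<comment> \<open>The three lower bounds on \<open>x\<close> make the powers, \<open>f\<close> and
    the remainder integrable, in this order. Subtracting the integrated truncation \<open>?P\<close>
    then leaves exactly the Laplace integral of \<open>?r\<close>.\<close>
  have bound: "\<bar>?R x\<bar> \<le> M * (fact (Suc N) / (x - \<gamma>) ^ (Suc N + 1))"
    if x: "x > 0" "x > \<beta>" "x > \<gamma>" for x
  proof -
    let ?P = "\<lambda>s. \<Sum>n\<le>N. c n * (s ^ n * exp (- (x * s)))"
    have "has_bochner_integral lebesgue
        (\<lambda>s. \<Sum>n\<le>N. c n * (indicator {0..} s *\<^sub>R (s ^ n * exp (- (x * s)))))
        (\<Sum>n\<le>N. c n * (fact n / x ^ (n + 1)))"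
      using has_bochner_integral_power_exp[OF x(1)]
      by (intro has_bochner_integral_sum has_bochner_integral_mult_right) auto
    also have "(\<lambda>s. \<Sum>n\<le>N. c n * (indicator {0..} s *\<^sub>R (s ^ n * exp (- (x * s))))) =
        (\<lambda>s. indicator {0..} s *\<^sub>R ?P s)"
      by (simp add: sum_distrib_left mult_ac)
    finally have P: "set_integrable lebesgue {0..} ?P"
        "(LINT s:{0..}|lebesgue. ?P s) = (\<Sum>n\<le>N. fact n * c n / x ^ (n + 1))"
      by (simp_all add: set_integrable_def set_lebesgue_integral_def has_bochner_integral_iff mult_ac)
    have f: "(\<lambda>s. exp (- (x * s)) * f s) absolutely_integrable_on {0..}"
      using absolutely_integrable_exp_bound(1)[OF cont _ x(2), of C 0] growth by simp
    have "?R x = (LINT s:{0..}|lebesgue. exp (- (x * s)) * f s - ?P s)"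
      using set_integral_diff(2)[OF f P(1)] P(2) by simp
    also have "\<dots> = (LINT s:{0..}|lebesgue. exp (- (x * s)) * ?r s)"
      by (simp add: algebra_simps sum_distrib_left)
    finally show ?thesis
      using absolutely_integrable_exp_bound(2)[OF cont_r M x(3)] by simp
  qed
  have "eventually (\<lambda>x. \<bar>?R x\<bar> \<le> M * (fact (Suc N) / (x - \<gamma>) ^ (Suc N + 1))) at_top"
    using eventually_gt_at_top[of 0] eventually_gt_at_top[of \<beta>] eventually_gt_at_top[of \<gamma>]
    by eventually_elim (rule bound)
  then have "?R \<in> O(\<lambda>x. M * (fact (Suc N) / (x - \<gamma>) ^ (Suc N + 1)))"
    by (intro bigoI[of _ 1]) (auto elim!: eventually_mono intro: order_trans[OF _ abs_ge_self] simp del: abs_divide abs_mult)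
  \<comment> \<open>The shift by \<open>\<gamma>\<close> is harmless: \<open>x\<close> is
    \<open>O(x - \<gamma>)\<close>, which passes to powers and, reversed, to reciprocals.\<close>
  also have "(\<lambda>x. M * (fact (Suc N) / (x - \<gamma>) ^ (Suc N + 1))) \<in> O(\<lambda>x. 1 / x ^ (Suc N + 1))"
  proof -
    have "(\<lambda>x::real. x) \<in> O(\<lambda>x. x - \<gamma>)"
      by real_asymp
    then have "(\<lambda>x. x ^ (Suc N + 1)) \<in> O(\<lambda>x. (x - \<gamma>) ^ (Suc N + 1))"
      by (rule landau_o.big_power)
    moreover have "eventually (\<lambda>x::real. x ^ (Suc N + 1) \<noteq> 0) at_top"
      using eventually_gt_at_top[of 0] by eventually_elim simp
    moreover have "eventually (\<lambda>x. (x - \<gamma>) ^ (Suc N + 1) \<noteq> 0) at_top"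
      using eventually_gt_at_top[of \<gamma>] by eventually_elim simp
    ultimately have "(\<lambda>x. 1 / (x - \<gamma>) ^ (Suc N + 1)) \<in> O(\<lambda>x. 1 / x ^ (Suc N + 1))"
      unfolding divide_inverse mult_1_left by (intro landau_o.big.inverse)
    then have "(\<lambda>x. (M * fact (Suc N)) * (1 / (x - \<gamma>) ^ (Suc N + 1)))
        \<in> O(\<lambda>x. 1 * (1 / x ^ (Suc N + 1)))"
      by (intro landau_o.big_mult) auto
    then show ?thesis by simp
  qed
  \<comment> \<open>The spare power of \<open>x\<close> turns the big-O into the required
    little-o.\<close>
  also have "(\<lambda>x. 1 / x ^ (Suc N + 1)) \<in> o(\<lambda>x::real. 1 / x ^ (N + 1))"
    by real_asymp
  finally show "?R \<in> o(\<lambda>x. 1 / x ^ (N + 1))" .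
qed

section \<open>Products of expansions at 0 and the Appell coefficients\<close>

text \<open>The error splits into (remainder of \<open>f\<close>) times \<open>g\<close>, plus each
  term \<open>c k * s ^ k\<close> times the remainder of \<open>g\<close> at order
  \<open>N - k\<close>. Letting the cut-off depend on \<open>k\<close> keeps just the pairs with
  \<open>k + j \<le> N\<close>, so no terms of higher degree are left over.\<close>

lemma asymp_series_at_zero_mult:
  assumes f: "asymp_series_at_zero f c" and g: "asymp_series_at_zero g d"
  shows "asymp_series_at_zero (\<lambda>s. f s * g s) (\<lambda>n. \<Sum>k\<le>n. c k * d (n - k))"
  unfolding asymp_series_at_zero_def
proof
  fix N
  let ?o = "o[at_right 0](\<lambda>s::real. s ^ N)"
  \<comment> \<open>The expansion of order 0 shows that \<open>g\<close> is bounded near 0.\<close>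
  have "(\<lambda>s. g s - d 0) \<in> o[at_right 0](\<lambda>s. 1)"
    using g[unfolded asymp_series_at_zero_def, rule_format, of 0] by simp
  then have "(\<lambda>s. (g s - d 0) + d 0) \<in> O[at_right 0](\<lambda>s. 1)"
    by (intro sum_in_bigo(1)) (simp_all add: landau_o.small_imp_big)
  then have "(\<lambda>s. (f s - (\<Sum>k\<le>N. c k * s ^ k)) * g s) \<in> o[at_right 0](\<lambda>s. s ^ N * 1)"
    using f unfolding asymp_series_at_zero_def by (intro landau_o.small_big_mult) auto
  moreover have "(\<lambda>s. \<Sum>k\<le>N. (c k * s ^ k) * (g s - (\<Sum>j\<le>N - k. d j * s ^ j))) \<in> ?o"
  proof (rule big_sum_in_smallo)
    fix k assume k: "k \<in> {..N}"
    have "(\<lambda>s. (c k * s ^ k) * (g s - (\<Sum>j\<le>N - k. d j * s ^ j)))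
        \<in> o[at_right 0](\<lambda>s. s ^ k * s ^ (N - k))"
      using g unfolding asymp_series_at_zero_def by (intro landau_o.big_small_mult) auto
    then show "(\<lambda>s. (c k * s ^ k) * (g s - (\<Sum>j\<le>N - k. d j * s ^ j))) \<in> ?o"
      using k by (simp flip: power_add)
  qed
  ultimately have "(\<lambda>s. (f s - (\<Sum>k\<le>N. c k * s ^ k)) * g s
      + (\<Sum>k\<le>N. (c k * s ^ k) * (g s - (\<Sum>j\<le>N - k. d j * s ^ j)))) \<in> ?o"
    by (intro sum_in_smallo) simp_all
  moreover have "(f s - (\<Sum>k\<le>N. c k * s ^ k)) * g s
      + (\<Sum>k\<le>N. (c k * s ^ k) * (g s - (\<Sum>j\<le>N - k. d j * s ^ j))) =
      f s * g s - (\<Sum>n\<le>N. (\<Sum>k\<le>n. c k * d (n - k)) * s ^ n)" for s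
  proof -
    \<comment> \<open>The triangle of pairs \<open>(k, j)\<close> is regrouped along its diagonals
      \<open>k + j = n\<close>.\<close>
    have "(\<Sum>k\<le>N. (c k * s ^ k) * (\<Sum>j\<le>N - k. d j * s ^ j)) =
        (\<Sum>(k, j)\<in>(SIGMA k:{..N}. {..N - k}). (c k * s ^ k) * (d j * s ^ j))"
      by (simp add: sum_distrib_left sum.Sigma)
    also have "(SIGMA k:{..N}. {..N - k}) = {(k, j). k + j \<le> N}"
      by auto
    also have "(\<Sum>(k, j)\<in>{(k, j). k + j \<le> N}. (c k * s ^ k) * (d j * s ^ j)) =
        (\<Sum>n\<le>N. \<Sum>k\<le>n. (c k * s ^ k) * (d (n - k) * s ^ (n - k)))"
      by (rule sum.triangle_reindex_eq)
    also have "\<dots> = (\<Sum>n\<le>N. (\<Sum>k\<le>n. c k * d (n - k)) * s ^ n)"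
    proof (intro sum.cong refl)
      fix n
      have "c k * s ^ k * (d (n - k) * s ^ (n - k)) = c k * d (n - k) * s ^ n" if "k \<le> n" for k
        using that power_add[of s k "n - k"] by simp
      then show "(\<Sum>k\<le>n. (c k * s ^ k) * (d (n - k) * s ^ (n - k))) = (\<Sum>k\<le>n. c k * d (n - k)) * s ^ n"
        by (auto simp only: sum_distrib_right atMost_iff intro!: sum.cong)
    qed
    finally show ?thesis
      by (simp add: algebra_simps sum_subtractf sum_distrib_left sum_distrib_right)
  qed
  ultimately show "(\<lambda>s. f s * g s - (\<Sum>n\<le>N. (\<Sum>k\<le>n. c k * d (n - k)) * s ^ n)) \<in> ?o"
    by simp
qed

lemma asymp_series_at_zero_exp:
  "asymp_series_at_zero (\<lambda>s. exp (u * s)) (\<lambda>n. u ^ n / fact n)"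
  unfolding asymp_series_at_zero_def
proof
  fix N
  have "\<bar>exp (u * s) - (\<Sum>n\<le>N. u ^ n / fact n * s ^ n)\<bar> \<le> exp \<bar>u\<bar> * \<bar>u\<bar> ^ Suc N * \<bar>s ^ Suc N\<bar>"
    if s: "0 < s" "s < 1" for s
  proof -
    \<comment> \<open>Lagrange form of the remainder: \<open>v\<close> varies with \<open>s\<close>,
      but for \<open>s < 1\<close> it stays within \<open>\<bar>u\<bar>\<close>, so the constant is
      uniform.\<close>
    obtain v where v: "\<bar>v\<bar> \<le> \<bar>u * s\<bar>"
      and e: "exp (u * s) = (\<Sum>m<Suc N. (u * s) ^ m / fact m) + exp v / fact (Suc N) * (u * s) ^ Suc N"
      using Maclaurin_exp_le by blast
    have "\<bar>u * s\<bar> \<le> \<bar>u\<bar>"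
      using s by (simp add: abs_mult mult_left_le)
    then have "exp v / fact (Suc N) \<le> exp \<bar>u\<bar> / 1"
      using v by (intro frac_le) (auto simp del: fact_Suc)
    then have "exp v / fact (Suc N) * \<bar>(u * s) ^ Suc N\<bar> \<le> exp \<bar>u\<bar> * \<bar>(u * s) ^ Suc N\<bar>"
      by (intro mult_right_mono) auto
    moreover have "exp (u * s) - (\<Sum>n\<le>N. u ^ n / fact n * s ^ n) =
        exp v / fact (Suc N) * (u * s) ^ Suc N"
      using e by (simp add: power_mult_distrib lessThan_Suc_atMost del: fact_Suc)
    ultimately show ?thesis
      by (simp add: abs_mult power_mult_distrib power_abs mult_ac del: fact_Suc power_Suc)
  qed
  moreover have "eventually (\<lambda>s::real. 0 < s \<and> s < 1) (at_right 0)"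
    by (auto simp: eventually_at_right_field intro!: exI[of _ 1])
  ultimately have "(\<lambda>s. exp (u * s) - (\<Sum>n\<le>N. u ^ n / fact n * s ^ n)) \<in> O[at_right 0](\<lambda>s. s ^ Suc N)"
    by (intro bigoI[of _ "exp \<bar>u\<bar> * \<bar>u\<bar> ^ Suc N"]) (auto elim!: eventually_mono)
  also have "(\<lambda>s. s ^ Suc N) \<in> o[at_right 0](\<lambda>s::real. s ^ N)"
    by real_asymp
  finally show "(\<lambda>s. exp (u * s) - (\<Sum>n\<le>N. u ^ n / fact n * s ^ n)) \<in> o[at_right 0](\<lambda>s. s ^ N)" .
qed

text \<open>The factor \<open>fact n\<close> from Watson's lemma and the two factorials of the
  Cauchy product form the binomial coefficient; the signs of orders \<open>k\<close> and
  \<open>n - k\<close> multiply to \<open>(- 1) ^ n\<close>.\<close>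

lemma appell_cauchy_product:
  "fact n * (\<Sum>k\<le>n. ((- 1) ^ k * a k / fact k) * ((- t) ^ (n - k) / fact (n - k))) =
     (- 1) ^ n * appell a n t"
proof -
  have "fact n * ((- 1) ^ k * a k / fact k * ((- t) ^ (n - k) / fact (n - k))) =
      (- 1) ^ n * (real (n choose k) * a k * t ^ (n - k))" if "k \<le> n" for k
  proof -
    have "(- t) ^ (n - k) = (- 1) ^ (n - k) * t ^ (n - k)"
      by (rule power_minus)
    moreover have "(- 1 :: real) ^ n = (- 1) ^ k * (- 1) ^ (n - k)"
      using that by (simp flip: power_add)
    ultimately show ?thesis
      using binomial_fact[OF that, where ?'a = real] by simp
  qed
  then show ?thesis
    by (auto simp: appell_def sum_distrib_left intro!: sum.cong)
qed

section \<open>Absolute convergence of the Borel-Laplace integral\<close>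

lemma infinitely_differentiable_on_imp_continuous_on:
  assumes "infinitely_differentiable_on f S"
  shows "continuous_on S f"
proof -
  obtain D where D: "\<And>x. x \<in> S \<Longrightarrow> D 0 x = f x"
      "\<And>n x. x \<in> S \<Longrightarrow> (D n has_real_derivative D (Suc n) x) (at x within S)"
    using assms unfolding infinitely_differentiable_on_def by metis
  then have "continuous_on S (D (0::nat))"
    by (intro DERIV_continuous_on)
  then show ?thesis
    using D(1) by (simp cong: continuous_on_cong)
qed

text \<open>Attaching \<open>exp (- t * s)\<close> to the kernel leaves \<open>x\<close> as the only
  Laplace variable; \<open>t\<close> merely lowers the growth rate by \<open>t\<close>.\<close>

lemma borel_integrand_eq:
  "borel_integrand K x t = (\<lambda>s. exp (- (x * s)) * (K s * exp (- t * s)))"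
  by (simp add: borel_integrand_def mult_ac fun_eq_iff)

lemma borel_integrand_absolutely_integrable:
  assumes K: "continuous_on {0..} K"
    and bound: "\<And>s. s \<ge> 0 \<Longrightarrow> \<bar>K s\<bar> \<le> M * exp (c * s)"
    and x: "x > c - t"
  shows "borel_integrand K x t absolutely_integrable_on {0..}"
  unfolding borel_integrand_eq
proof (rule absolutely_integrable_exp_bound(1))
  show "continuous_on {0..} (\<lambda>s. K s * exp (- t * s))"
    by (intro continuous_intros K)
  show "\<bar>K s * exp (- t * s)\<bar> \<le> M * (s ^ 0 * exp ((c - t) * s))" if "s \<ge> 0" for s
  proof -
    have "\<bar>K s * exp (- t * s)\<bar> \<le> M * exp (c * s) * exp (- t * s)"
      using bound[OF that] by (simp add: abs_mult)
    then show ?thesis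
      by (simp add: algebra_simps flip: exp_add)
  qed
qed (rule x)

lemma rapidly_decaying_imp_absolutely_integrable:
  assumes K: "continuous_on {0..} K" and decay: "rapidly_decaying K"
  shows "borel_integrand K x t absolutely_integrable_on {0..}"
proof -
  \<comment> \<open>Any \<open>c\<close> below \<open>x + t\<close> would do: a bound of rate
    \<open>c\<close> gives convergence at \<open>x\<close>.\<close>
  define c where "c = x + t - 1"
  have "K \<in> O(\<lambda>s. exp (c * s))"
    using decay[unfolded rapidly_decaying_def, rule_format, of "- c"] by simp
  then obtain B where "B > 0" and "eventually (\<lambda>s. norm (K s) \<le> B * norm (exp (c * s))) at_top"
    by (elim landau_o.bigE)
  then obtain T where T: "\<And>s. s \<ge> T \<Longrightarrow> \<bar>K s\<bar> \<le> B * exp (c * s)"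
    by (auto simp: eventually_at_top_linorder)
  \<comment> \<open>The decay holds only from \<open>T\<close> on; compactness supplies the constant
    on the initial segment.\<close>
  have "continuous_on {0..T} (\<lambda>s. K s / exp (c * s))"
    by (intro continuous_intros continuous_on_subset[OF K]) auto
  then have "bounded ((\<lambda>s. K s / exp (c * s)) ` {0..T})"
    by (intro compact_imp_bounded compact_continuous_image) auto
  then obtain E where E: "\<And>s. 0 \<le> s \<Longrightarrow> s \<le> T \<Longrightarrow> \<bar>K s / exp (c * s)\<bar> \<le> E"
    unfolding bounded_iff real_norm_def by (metis atLeastAtMost_iff imageI)
  have "\<bar>K s\<bar> \<le> max B E * exp (c * s)" if "s \<ge> 0" for s
  proof (cases "s \<le> T")
    case True
    then have "\<bar>K s\<bar> \<le> E * exp (c * s)"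
      using E[OF that] by (simp add: field_simps)
    also have "\<dots> \<le> max B E * exp (c * s)"
      by (intro mult_right_mono) auto
    finally show ?thesis .
  next
    case False
    then have "\<bar>K s\<bar> \<le> B * exp (c * s)"
      using T by simp
    also have "\<dots> \<le> max B E * exp (c * s)"
      by (intro mult_right_mono) auto
    finally show ?thesis .
  qed
  then show ?thesis
    by (rule borel_integrand_absolutely_integrable[OF K]) (simp_all add: c_def)
qed

section \<open>The Gaussian kernel\<close>

lemma infinitely_differentiable_on_gaussian_kernel:
  "infinitely_differentiable_on gaussian_kernel S"
proof -
  \<comment> \<open>Each derivative is a polynomial times the Gaussian; up to the sign
    \<open>(- 1) ^ n\<close>, \<open>H n\<close> is the probabilists' Hermite polynomial.\<close>
  define H :: "nat \<Rightarrow> real poly" where "H n = ((\<lambda>p. pderiv p - [:0, 1:] * p) ^^ n) 1" for n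
  have H: "H (Suc n) = pderiv (H n) - [:0, 1:] * H n" for n
    by (simp add: H_def)
  have "((\<lambda>s. poly (H n) s * gaussian_kernel s) has_real_derivative
      poly (H (Suc n)) s * gaussian_kernel s) (at s within S)" for n s
    unfolding gaussian_kernel_def H
    by (auto intro!: derivative_eq_intros simp: algebra_simps)
  moreover have "poly (H 0) s * gaussian_kernel s = gaussian_kernel s" for s
    by (simp add: H_def)
  ultimately show ?thesis
    unfolding infinitely_differentiable_on_def
    by (intro exI[of _ "\<lambda>n s. poly (H n) s * gaussian_kernel s"]) blast
qed

lemma rapidly_decaying_gaussian_kernel: "rapidly_decaying gaussian_kernel"
  unfolding rapidly_decaying_def
proof
  fix c :: real
  \<comment> \<open>The constant comes from completing the square in
    \<open>s\<^sup>2 / 2 - c * s\<close>.\<close>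
  have "gaussian_kernel s \<le> exp (c\<^sup>2 / 2) * exp (- (c * s))" for s
  proof -
    have "0 \<le> (s - c)\<^sup>2 / 2"
      by simp
    then have "- (s\<^sup>2 / 2) \<le> c\<^sup>2 / 2 + - (c * s)"
      by (simp add: power2_diff field_simps)
    then show ?thesis
      by (simp add: gaussian_kernel_def flip: exp_add)
  qed
  then show "gaussian_kernel \<in> O(\<lambda>s. exp (- (c * s)))"
    by (intro bigoI[of _ "exp (c\<^sup>2 / 2)"]) (simp add: gaussian_kernel_def)
qed

section \<open>The asymptotic series and the full statement\<close>

text \<open>Watson's lemma for \<open>K s * exp (- t * s)\<close>, with growth rate
  \<open>b - t\<close> of either sign.\<close>

theorem borel_laplace_asymp_series:
  assumes K: "continuous_on {0..} K"
    and growth: "\<And>s. s \<ge> 0 \<Longrightarrow> \<bar>K s\<bar> \<le> C * exp (b * s)"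
    and taylor: "asymp_series_at_zero K (\<lambda>n. (- 1) ^ n * a n / fact n)"
  shows "asymp_series_at_top (\<lambda>x. borel_laplace K x t) (\<lambda>n. (- 1) ^ n * appell a n t)"
proof -
  have "continuous_on {0..} (\<lambda>s. K s * exp (- t * s))"
    by (intro continuous_intros K)
  moreover have "\<bar>K s * exp (- t * s)\<bar> \<le> C * exp ((b - t) * s)" if "s \<ge> 0" for s
  proof -
    have "\<bar>K s * exp (- t * s)\<bar> \<le> C * exp (b * s) * exp (- t * s)"
      using growth[OF that] by (simp add: abs_mult)
    then show ?thesis
      by (simp add: algebra_simps flip: exp_add)
  qed
  ultimately show ?thesis
    using watson[OF _ _ asymp_series_at_zero_mult[OF taylor asymp_series_at_zero_exp[of "- t"]]]
    unfolding borel_laplace_def borel_integrand_eq appell_cauchy_product by blast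
qed

text \<open>The closing remark on rapid decay is rendered for arbitrary smooth kernels
  \<open>K\<close>, separate from \<open>A\<close>; the Gaussian is then shown to be such a
  kernel.\<close>

theorem proposition2p3:
  fixes a :: "nat \<Rightarrow> real" and A :: "real \<Rightarrow> real" and C b :: real
  assumes a0: "a 0 \<noteq> 0"
    and smooth: "infinitely_differentiable_on (\<lambda>s. A (- s)) {0..}"
    and C: "C > 0" and b: "b \<ge> 0"
    and growth: "\<And>s. s \<ge> 0 \<Longrightarrow> \<bar>A (- s)\<bar> \<le> C * exp (b * s)"
    and taylor: "asymp_series_at_zero (\<lambda>s. A (- s)) (\<lambda>n. (- 1) ^ n * a n / fact n)"
  shows "(\<forall>t. (\<forall>x. x > b - t \<longrightarrow>
                 borel_integrand (\<lambda>s. A (- s)) x t absolutely_integrable_on {0..}) \<and>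
              asymp_series_at_top (\<lambda>x. borel_laplace (\<lambda>s. A (- s)) x t)
                (\<lambda>n. (- 1) ^ n * appell a n t))
       \<and> (\<forall>K. infinitely_differentiable_on K {0..} \<and> rapidly_decaying K \<longrightarrow>
            (\<forall>t x. borel_integrand K x t absolutely_integrable_on {0..}))
       \<and> infinitely_differentiable_on gaussian_kernel {0..} \<and> rapidly_decaying gaussian_kernel
       \<and> (\<forall>t x. borel_integrand gaussian_kernel x t absolutely_integrable_on {0..})"
proof -
  have cont: "continuous_on {0..} (\<lambda>s. A (- s))"
    using smooth by (rule infinitely_differentiable_on_imp_continuous_on)
  show ?thesis
    using borel_integrand_absolutely_integrable[OF cont growth]
      borel_laplace_asymp_series[OF cont growth taylor]
      rapidly_decaying_imp_absolutely_integrable infinitely_differentiable_on_imp_continuous_on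
      infinitely_differentiable_on_gaussian_kernel rapidly_decaying_gaussian_kernel
    by (intro conjI allI impI) blast+
qed

end
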